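(* Let $Z$ be a Banach space with a $1$-unconditional basis $(z_n)_{n=1}^\infty$, let $(Y_n)_{n=1}^\infty$ be a sequence of nonzero separable Banach spaces, and let $Y_Z=(\oplus_n Y_n)_Z$, with each $Y_n$ regarded as a subspace of $Y_Z$ in the natural way. For each $n\in\mathbb{N}$ let $S_n=(y_i^n)_{i=1}^\infty\subset Y_n\setminus\{0\}$ be a sequence dense in $Y_n$, and let $(y_i)_{i=1}^\infty$ be an enumeration of $\bigcup_n S_n$ such that for each $k\in\mathbb{N}$, $\{y_1,\dots,y_k\}\subset \bigcup_{i=1}^k Y_i$. Let $X$ be a separable Banach space and let $C,D\geqslant 1$. If there exists a $(\oplus_n Y_n)_Z$-tree in $X$ with constants $C,D$ having order $\omega_1$, then $o(T(X,D,(y_i)))=\omega_1$, and consequently $Y_Z$ $D$-embeds into $X$.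
   Context: All Banach spaces are over the same scalar field $\mathbb{F}$ ($\mathbb{R}$ or $\mathbb{C}$). The space $Y_Z=(\oplus_n Y_n)_Z$ consists of all sequences $(y_n)_n$ with $y_n\in Y_n$ such that $\sum_n\|y_n\|z_n$ converges in $Z$, with norm $\|(y_n)_n\|=\|\sum_n\|y_n\|z_n\|_Z$. The space $Y_n$ is identified with the subspace of sequences supported in the $n$-th coordinate. Trees: a set $T$ of finite sequences is a tree if every initial segment of a member of $T$ is a member of $T$. A subtree of $T$ is a subset of $T$ which is itself a tree. Order: for a tree $T$, let $T'$ be the set of members of $T$ having a proper extension in $T$. Put $T^0=T$, $T^{\xi+1}=(T^\xi)'$, and $T^\xi=\bigcap_{\zeta<\xi}T^\zeta$ for limit ordinals $\xi$. The order $o(T)$ is the least countable ordinal $\xi$ with $T^\xi=\varnothing$ if such a $\xi$ exists, and $o(T)=\omega_1$ (the first uncountable ordinal) otherwise. Thus $o(T)$ is always either a countable ordinal or $\omega_1$, and "uncountable order" means order $\omega_1$. The tree $T(C,D,X)$: for constants $C,D\geqslant 1$, $T(C,D,X)$ is the set of all finite sequences of bounded linear operators $(A_i)_{i=1}^n$ such that (i) for each $1\leqslant i\leqslant n$, $A_i:Y_i\to X$ satisfies $\|y\|\leqslant\|A_iy\|\leqslant C\|y\|$ for all $y\in Y_i$; (ii) for all $y_i\in Y_i$ ($1\leqslant i\leqslant n$), $\|\sum_{i=1}^nA_iy_i\|\leqslant\|\sum_{i=1}^n\|y_i\|z_i\|_Z\leqslant D\|\sum_{i=1}^nA_iy_i\|$.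 A $(\oplus_nY_n)_Z$-tree in $X$ with constants $C,D$ is a subset of $T(C,D,X)$ closed under taking initial segments, i.e. a subtree of $T(C,D,X)$. The tree $T(X,D,(y_i))$: for a sequence $(y_i)$ with dense span in a Banach space $Y$ (here $Y=Y_Z$), $T(X,D,(y_i))$ is the set of all finite sequences $(x_i)_{i=1}^n$ in $X$ such that for all scalars $(a_i)_{i=1}^n\subset\mathbb{F}$, $$\Bigl\|\sum_{i=1}^na_ix_i\Bigr\|\leqslant\Bigl\|\sum_{i=1}^na_iy_i\Bigr\|\leqslant D\Bigl\|\sum_{i=1}^na_ix_i\Bigr\|.$$ $D$-embedding: $Y$ $D$-embeds into $X$ if there is a linear isomorphic embedding $A:Y\to X$ with $\|A\|\leqslant1$ and $\|A^{-1}:A(Y)\to Y\|\leqslant D$. *)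

theory Defs
  imports "HOL-Analysis.Analysis" "HOL-Library.Sublist"
begin

section \<open>Normed spaces over \<open>\<real>\<close> or \<open>\<complex>\<close>\<close>

text \<open>
  The scalar field is a type \<open>'f :: {real_normed_field, euclidean_space}\<close>.  Both \<^typ>\<open>real\<close> and
  \<^typ>\<open>complex\<close> are instances, and (Frobenius) they are the only ones up to isometric isomorphism.
  The classes \<open>real_normed_vector\<close> and \<open>banach\<close> only provide multiplication by reals; the locale
  adds a multiplication by \<open>'f\<close> that is compatible with it and with the norm.
\<close>

locale normed_space_over = vector_space scale
  for scale :: "'f::{real_normed_field,euclidean_space} \<Rightarrow> 'v::real_normed_vector \<Rightarrow> 'v" +
  assumes scale_of_real: "scale (of_real r) v = r *\<^sub>R v"
    and norm_scale: "norm (scale a v) = norm a * norm v"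

definition schauder_basis ::
  "('f::{real_normed_field,euclidean_space} \<Rightarrow> 'z::real_normed_vector \<Rightarrow> 'z) \<Rightarrow> (nat \<Rightarrow> 'z) \<Rightarrow> bool"
  where "schauder_basis sZ z \<longleftrightarrow> (\<forall>v. \<exists>!a. (\<lambda>n. sZ (a n) (z n)) sums v)"

text \<open>
  Only the signs \<open>\<epsilon>\<^sub>i = \<plusminus>1\<close> are used, also over \<^typ>\<open>complex\<close>.  A basis that is 1-unconditional in the
  sense of arbitrary unimodular \<open>\<epsilon>\<^sub>i\<close>, or in the sense that the norm is monotone in the moduli of the
  coefficients, has this property as well.
\<close>

definition one_unconditional_basis ::
  "('f::{real_normed_field,euclidean_space} \<Rightarrow> 'z::real_normed_vector \<Rightarrow> 'z) \<Rightarrow> (nat \<Rightarrow> 'z) \<Rightarrow> bool"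
  where "one_unconditional_basis sZ z \<longleftrightarrow> schauder_basis sZ z \<and>
    (\<forall>n a \<epsilon>. (\<forall>i<n. \<epsilon> i \<in> {1, -1}) \<longrightarrow>
       norm (\<Sum>i<n. sZ (\<epsilon> i * a i) (z i)) \<le> norm (\<Sum>i<n. sZ (a i) (z i)))"


section \<open>The space \<open>Y\<^sub>Z\<close>\<close>

text \<open>
  Sequences are indexed from 0.  The spaces \<open>Y\<^sub>n\<close> are complete subspaces of one normed space, which is
  otherwise arbitrary and need not be complete.  This is no restriction: every sequence of Banach
  spaces is isometric to the sequence of coordinate subspaces of its \<open>\<ell>\<^sub>\<infinity>\<close>-sum.  How the \<open>Y\<^sub>n\<close> lie
  in the ambient space relative to each other plays no role.
\<close>

definition YZ :: "(nat \<Rightarrow> 'y::real_normed_vector set) \<Rightarrow> (nat \<Rightarrow> 'z::real_normed_vector) \<Rightarrow> (nat \<Rightarrow> 'y) set"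
  where "YZ Y z = {y. (\<forall>n. y n \<in> Y n) \<and> summable (\<lambda>n. norm (y n) *\<^sub>R z n)}"

definition YZ_norm :: "(nat \<Rightarrow> 'z::real_normed_vector) \<Rightarrow> (nat \<Rightarrow> 'y::real_normed_vector) \<Rightarrow> real"
  where "YZ_norm z y = norm (\<Sum>n. norm (y n) *\<^sub>R z n)"

text \<open>The natural inclusion of \<open>Y\<^sub>n\<close> into \<open>Y\<^sub>Z\<close>.\<close>

definition coord_embed :: "nat \<Rightarrow> 'y::zero \<Rightarrow> nat \<Rightarrow> 'y"
  where "coord_embed n v = (\<lambda>m. if m = n then v else 0)"

text \<open>
  The last two conjuncts say \<open>\<parallel>A\<parallel> \<le> 1\<close> and \<open>\<parallel>A\<^sup>-\<^sup>1 : A(Y\<^sub>Z) \<rightarrow> Y\<^sub>Z\<parallel> \<le> D\<close>, where \<open>Y\<^sub>Z\<close> carries the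
  coordinatewise operations.
\<close>

definition YZ_embeds ::
  "('f \<Rightarrow> 'y::real_normed_vector \<Rightarrow> 'y) \<Rightarrow> (nat \<Rightarrow> 'y set) \<Rightarrow> (nat \<Rightarrow> 'z::real_normed_vector) \<Rightarrow>
   ('f \<Rightarrow> 'x::real_normed_vector \<Rightarrow> 'x) \<Rightarrow> real \<Rightarrow> bool"
  where "YZ_embeds sY Y z sX D \<longleftrightarrow> (\<exists>A :: (nat \<Rightarrow> 'y) \<Rightarrow> 'x.
     (\<forall>u\<in>YZ Y z. \<forall>v\<in>YZ Y z. A (\<lambda>n. u n + v n) = A u + A v) \<and>
     (\<forall>c. \<forall>u\<in>YZ Y z. A (\<lambda>n. sY c (u n)) = sX c (A u)) \<and>
     inj_on A (YZ Y z) \<and>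
     (\<forall>u\<in>YZ Y z. norm (A u) \<le> YZ_norm z u) \<and>
     (\<forall>x\<in>A ` YZ Y z. YZ_norm z (inv_into (YZ Y z) A x) \<le> D * norm x))"


section \<open>Countable ordinals\<close>

text \<open>
  \<^term>\<open>cardSuc natLeq\<close> is a well-order of type \<open>\<omega>\<^sub>1\<close>, so its elements serve as the countable ordinals;
  compare \<open>countable_below\<close> and \<open>uncountable_ctbl_ord\<close> below.
\<close>

typedef ctbl_ord = "Field (cardSuc natLeq)"
proof -
  have "infinite (Field (cardSuc natLeq))"
    using cardSuc_finite[OF natLeq_Card_order] by (simp add: Field_natLeq)
  then show ?thesis using infinite_imp_nonempty by blast
qed

lemma cardSuc_natLeq_Well_order: "Well_order (cardSuc natLeq)"
  using cardSuc_Card_order[OF natLeq_Card_order] by (simp add: card_order_on_def)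

instantiation ctbl_ord :: wellorder
begin

definition less_eq_ctbl_ord :: "ctbl_ord \<Rightarrow> ctbl_ord \<Rightarrow> bool"
  where "(a::ctbl_ord) \<le> b \<longleftrightarrow> (Rep_ctbl_ord a, Rep_ctbl_ord b) \<in> cardSuc natLeq"

definition less_ctbl_ord :: "ctbl_ord \<Rightarrow> ctbl_ord \<Rightarrow> bool"
  where "(a::ctbl_ord) < b \<longleftrightarrow> a \<le> b \<and> a \<noteq> b"

instance
proof -
  let ?r = "cardSuc natLeq"
  have wo: "Well_order ?r" by (rule cardSuc_natLeq_Well_order)
  then have rf: "refl_on (Field ?r) ?r" and tr: "trans ?r" and an: "antisym ?r"
    and tot: "total_on (Field ?r) ?r" and wf: "wf (?r - Id)"
    by (auto simp: order_on_defs)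
  have refl: "a \<le> a" for a :: ctbl_ord
    using rf Rep_ctbl_ord by (auto simp: less_eq_ctbl_ord_def refl_on_def)
  have trn: "a \<le> b \<Longrightarrow> b \<le> c \<Longrightarrow> a \<le> c" for a b c :: ctbl_ord
    unfolding less_eq_ctbl_ord_def using tr by (meson transD)
  have asym: "a \<le> b \<Longrightarrow> b \<le> a \<Longrightarrow> a = b" for a b :: ctbl_ord
    unfolding less_eq_ctbl_ord_def using an by (metis antisymD Rep_ctbl_ord_inject)
  have lin: "a \<le> b \<or> b \<le> a" for a b :: ctbl_ord
    using tot refl Rep_ctbl_ord[of a] Rep_ctbl_ord[of b]
    by (metis less_eq_ctbl_ord_def total_on_def)
  have "{(a, b). a < b} = inv_image (?r - Id) Rep_ctbl_ord"
    by (auto simp: less_ctbl_ord_def less_eq_ctbl_ord_def Rep_ctbl_ord_inject)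
  then have wf': "wf {(a :: ctbl_ord, b). a < b}"
    using wf by simp
  show "OFCLASS(ctbl_ord, wellorder_class)"
  proof
    fix a b c :: ctbl_ord
    show "(a < b) = (a \<le> b \<and> \<not> b \<le> a)"
      using asym refl by (auto simp: less_ctbl_ord_def)
    show "a \<le> a" by (rule refl)
    show "a \<le> b \<Longrightarrow> b \<le> c \<Longrightarrow> a \<le> c" by (rule trn)
    show "a \<le> b \<Longrightarrow> b \<le> a \<Longrightarrow> a = b" by (rule asym)
    show "a \<le> b \<or> b \<le> a" by (rule lin)
  next
    fix P :: "ctbl_ord \<Rightarrow> bool" and a
    assume "\<And>x. (\<And>y. y < x \<Longrightarrow> P y) \<Longrightarrow> P x"
    then show "P a" using wf_induct[OF wf', of P] by blast
  qed
qed

end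

lemma countable_below: "countable {\<zeta> :: ctbl_ord. \<zeta> < \<xi>}"
proof -
  include cardinal_syntax
  let ?r = "cardSuc natLeq"
  have co: "Card_order ?r" by (rule cardSuc_Card_order[OF natLeq_Card_order])
  have "|underS ?r (Rep_ctbl_ord \<xi>)| <o ?r"
    using card_of_underS[OF co] Rep_ctbl_ord by blast
  then have "|underS ?r (Rep_ctbl_ord \<xi>)| \<le>o natLeq"
    using cardSuc_ordLeq_ordLess[OF natLeq_Card_order card_of_Card_order] by blast
  then have "|underS ?r (Rep_ctbl_ord \<xi>)| \<le>o |UNIV :: nat set|"
    using card_of_nat ordIso_symmetric ordLeq_ordIso_trans by blast
  then have "countable (underS ?r (Rep_ctbl_ord \<xi>))"
    using card_of_ordLeq[of _ "UNIV :: nat set"] by (auto simp: countable_def)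
  moreover have "Rep_ctbl_ord ` {\<zeta>. \<zeta> < \<xi>} \<subseteq> underS ?r (Rep_ctbl_ord \<xi>)"
    by (auto simp: underS_def less_ctbl_ord_def less_eq_ctbl_ord_def Rep_ctbl_ord_inject)
  ultimately have "countable (Rep_ctbl_ord ` {\<zeta>. \<zeta> < \<xi>})"
    using countable_subset by blast
  then show ?thesis
    by (rule countable_image_inj_on) (auto simp: inj_on_def Rep_ctbl_ord_inject)
qed

lemma uncountable_ctbl_ord: "uncountable (UNIV :: ctbl_ord set)"
proof
  include cardinal_syntax
  let ?r = "cardSuc natLeq"
  assume "countable (UNIV :: ctbl_ord set)"
  then have "countable (range Rep_ctbl_ord)" by simp
  moreover have "range Rep_ctbl_ord = Field ?r"
    using type_definition.Rep_range[OF type_definition_ctbl_ord] .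
  ultimately have "|Field ?r| \<le>o |UNIV :: nat set|"
    using card_of_ordLeq[of _ "UNIV :: nat set"] by (auto simp: countable_def)
  then have "?r \<le>o natLeq"
    using card_of_nat card_of_Field_ordIso[OF cardSuc_Card_order[OF natLeq_Card_order]]
    by (meson ordIso_ordLeq_trans ordIso_symmetric ordLeq_ordIso_trans)
  then show False
    using cardSuc_greater[OF natLeq_Card_order] not_ordLess_ordLeq by blast
qed

definition ozero :: ctbl_ord
  where "ozero = (LEAST \<xi>. True)"

definition osucc :: "ctbl_ord \<Rightarrow> ctbl_ord"
  where "osucc \<xi> = (LEAST \<zeta>. \<xi> < \<zeta>)"

definition olimit :: "ctbl_ord \<Rightarrow> bool"
  where "olimit \<xi> \<longleftrightarrow> \<xi> \<noteq> ozero \<and> (\<forall>\<zeta>. \<xi> \<noteq> osucc \<zeta>)"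

lemma less_osucc: "\<xi> < osucc \<xi>"
proof -
  have "{\<zeta>. \<zeta> < \<xi>} \<union> {\<xi>} \<noteq> UNIV"
    using countable_below[of \<xi>] uncountable_ctbl_ord
    by (metis countable_Un_iff countable_finite finite.emptyI finite.insertI)
  then obtain \<zeta> where "\<xi> < \<zeta>"
    by (metis (mono_tags, lifting) UNIV_eq_I Un_iff insertI1 linorder_neqE mem_Collect_eq)
  then show ?thesis unfolding osucc_def by (rule LeastI)
qed

lemma osucc_le_iff: "osucc \<xi> \<le> \<zeta> \<longleftrightarrow> \<xi> < \<zeta>"
  using less_osucc[of \<xi>] by (metis Least_le order_less_le_trans osucc_def)

lemma osucc_inject [simp]: "osucc \<xi> = osucc \<zeta> \<longleftrightarrow> \<xi> = \<zeta>"
  by (metis less_osucc linorder_neqE not_less osucc_le_iff)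

lemma ozero_le [simp]: "ozero \<le> \<xi>"
  unfolding ozero_def by (simp add: Least_le)

lemma osucc_neq_ozero [simp]: "osucc \<xi> \<noteq> ozero"
  using less_osucc[of \<xi>] ozero_le[of \<xi>] by (metis not_le)


section \<open>Trees and their order\<close>

text \<open>The empty sequence counts as an initial segment, so every nonempty tree contains it.\<close>

definition is_tree :: "'a list set \<Rightarrow> bool"
  where "is_tree T \<longleftrightarrow> (\<forall>s\<in>T. \<forall>t. prefix t s \<longrightarrow> t \<in> T)"

definition tree_derived :: "'a list set \<Rightarrow> 'a list set"
  where "tree_derived T = {s\<in>T. \<exists>t\<in>T. strict_prefix s t}"

function tree_deriv :: "'a list set \<Rightarrow> ctbl_ord \<Rightarrow> 'a list set"
  where "tree_deriv T \<xi> =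
    (if \<xi> = ozero then T
     else if \<exists>\<zeta>. \<xi> = osucc \<zeta> then tree_derived (tree_deriv T (THE \<zeta>. \<xi> = osucc \<zeta>))
     else (\<Inter>\<zeta>\<in>{\<zeta>. \<zeta> < \<xi>}. tree_deriv T \<zeta>))"
  by pat_completeness auto
termination
proof (relation "inv_image {(\<zeta>, \<xi>). \<zeta> < \<xi>} snd")
  show "wf (inv_image {(\<zeta> :: ctbl_ord, \<xi>). \<zeta> < \<xi>} snd)"
    using wf by (rule wf_inv_image)
qed (auto simp: less_osucc)

declare tree_deriv.simps [simp del]

lemma tree_deriv_zero: "tree_deriv T ozero = T"
  by (simp add: tree_deriv.simps)

lemma tree_deriv_succ: "tree_deriv T (osucc \<xi>) = tree_derived (tree_deriv T \<xi>)"
  by (simp add: tree_deriv.simps[of T "osucc \<xi>"])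

lemma tree_deriv_limit: "olimit \<xi> \<Longrightarrow> tree_deriv T \<xi> = (\<Inter>\<zeta>\<in>{\<zeta>. \<zeta> < \<xi>}. tree_deriv T \<zeta>)"
  by (subst tree_deriv.simps) (simp add: olimit_def)

datatype ord_le_omega1 = Countable_Ord ctbl_ord | Omega1

definition tree_order :: "'a list set \<Rightarrow> ord_le_omega1"
  where "tree_order T =
    (if \<exists>\<xi>. tree_deriv T \<xi> = {} then Countable_Ord (LEAST \<xi>. tree_deriv T \<xi> = {}) else Omega1)"


section \<open>The two trees\<close>

text \<open>
  An operator with domain \<open>V\<close> is a total function which is \<open>undefined\<close> outside \<open>V\<close>, so that operators
  on \<open>V\<close> are equal iff they agree on \<open>V\<close>.
\<close>

definition bounded_operator_on ::
  "('f \<Rightarrow> 'y::real_normed_vector \<Rightarrow> 'y) \<Rightarrow> 'y set \<Rightarrow> ('f \<Rightarrow> 'x::real_normed_vector \<Rightarrow> 'x) \<Rightarrow> ('y \<Rightarrow> 'x) \<Rightarrow> bool"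
  where "bounded_operator_on sY V sX A \<longleftrightarrow>
    A \<in> extensional V \<and>
    (\<forall>u\<in>V. \<forall>v\<in>V. A (u + v) = A u + A v) \<and>
    (\<forall>c. \<forall>u\<in>V. A (sY c u) = sX c (A u)) \<and>
    (\<exists>K. \<forall>u\<in>V. norm (A u) \<le> K * norm u)"

definition operator_tree ::
  "('f \<Rightarrow> 'y::real_normed_vector \<Rightarrow> 'y) \<Rightarrow> (nat \<Rightarrow> 'y set) \<Rightarrow> (nat \<Rightarrow> 'z::real_normed_vector) \<Rightarrow>
   ('f \<Rightarrow> 'x::real_normed_vector \<Rightarrow> 'x) \<Rightarrow> real \<Rightarrow> real \<Rightarrow> ('y \<Rightarrow> 'x) list set"
  where "operator_tree sY Y z sX C D = {As.
    (\<forall>i<length As. bounded_operator_on sY (Y i) sX (As ! i) \<and>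
       (\<forall>y\<in>Y i. norm y \<le> norm ((As ! i) y) \<and> norm ((As ! i) y) \<le> C * norm y)) \<and>
    (\<forall>y. (\<forall>i<length As. y i \<in> Y i) \<longrightarrow>
       norm (\<Sum>i<length As. (As ! i) (y i)) \<le> norm (\<Sum>i<length As. norm (y i) *\<^sub>R z i) \<and>
       norm (\<Sum>i<length As. norm (y i) *\<^sub>R z i) \<le> D * norm (\<Sum>i<length As. (As ! i) (y i)))}"

definition vector_tree ::
  "('f \<Rightarrow> 'y::real_normed_vector \<Rightarrow> 'y) \<Rightarrow> (nat \<Rightarrow> 'z::real_normed_vector) \<Rightarrow>
   ('f \<Rightarrow> 'x::real_normed_vector \<Rightarrow> 'x) \<Rightarrow> real \<Rightarrow> (nat \<Rightarrow> nat \<Rightarrow> 'y) \<Rightarrow> 'x list set"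
  where "vector_tree sY z sX D y = {xs. \<forall>a.
    norm (\<Sum>i<length xs. sX (a i) (xs ! i)) \<le> YZ_norm z (\<lambda>n. \<Sum>i<length xs. sY (a i) (y i n)) \<and>
    YZ_norm z (\<lambda>n. \<Sum>i<length xs. sY (a i) (y i n)) \<le> D * norm (\<Sum>i<length xs. sX (a i) (xs ! i))}"

end

theory Submission
  imports Defs
begin

text \<open>
  An operator tree is turned into a vector tree by evaluation.  Every \<open>y\<^sub>k\<close> lives in a single
  coordinate \<open>m k \<le> k\<close>, so a node \<open>(A\<^sub>0, \<dots>, A\<^sub>n)\<close> determines the vectors \<open>x\<^sub>k = A\<^bsub>m k\<^esub> y\<^sub>k\<close> for
  \<open>k \<le> n\<close>.  A linear combination of the \<open>x\<^sub>k\<close> regroups, coordinate by coordinate, into the image of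
  the same combination of the \<open>y\<^sub>k\<close>, and the two inequalities required of the operators become those
  required of the vectors (\<open>operator_tree_to_vector_tree\<close>).  Evaluation preserves lengths and extensions
  of nodes, so it maps each derivative into the corresponding derivative
  (\<open>tree_deriv_image\<close>), and the vector tree has order \<open>\<omega>\<^sub>1\<close> as well.

  The vector tree is closed, and the space \<open>X\<close> is separable and complete, so the order \<open>\<omega>\<^sub>1\<close> forces an
  infinite branch (\<open>closed_tree_infinite_branch\<close>).  To find it, call a set of sequences of
  length \<open>n\<close> persistent if it meets all derivatives.  By separability, the one-step extensions
  of the members of a persistent set fall into countably many pieces of small diameter; since a
  countable set of countable ordinals is bounded, one of the pieces is again persistent.
  Iterating this with diameters tending to 0 gives Cauchy sequences in every coordinate, whose
  limits form the branch.

  Along a branch \<open>(x\<^sub>k)\<close> the map \<open>y\<^sub>k \<mapsto> x\<^sub>k\<close> extends linearly to the span of the \<open>y\<^sub>k\<close> with exactly the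
  required constants, and then by density to the whole direct sum (\<open>YZ_embeds_of_branch\<close>).  That the
  direct sum is a normed space in which finitely supported sequences are dense rests on the
  monotonicity of the norm in the moduli of the coefficients (\<open>unconditional_mono\<close>), which is
  derived from invariance under changes of sign by convexity.
\<close>


section \<open>Derivatives of trees\<close>

lemma ctbl_ord_cases:
  obtains (zero) "\<xi> = ozero" | (succ) \<zeta> where "\<xi> = osucc \<zeta>" | (limit) "olimit \<xi>"
  unfolding olimit_def by blast

lemma tree_order_Omega1_iff: "tree_order T = Omega1 \<longleftrightarrow> (\<forall>\<xi>. tree_deriv T \<xi> \<noteq> {})"
  by (auto simp: tree_order_def)

lemma tree_deriv_antimono: "\<zeta> \<le> \<xi> \<Longrightarrow> tree_deriv T \<xi> \<subseteq> tree_deriv T \<zeta>"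
proof (induction \<xi> rule: less_induct)
  case (less \<xi>)
  show ?case
  proof (cases "\<zeta> = \<xi>")
    case False
    then have lt: "\<zeta> < \<xi>" using less.prems by simp
    show ?thesis
    proof (cases \<xi> rule: ctbl_ord_cases)
      case zero
      then show ?thesis using lt ozero_le[of \<zeta>] by (meson not_le)
    next
      case (succ \<eta>)
      then have "\<zeta> \<le> \<eta>" using lt osucc_le_iff[of \<eta> \<zeta>] by auto
      then have "tree_deriv T \<eta> \<subseteq> tree_deriv T \<zeta>"
        using less.IH[of \<eta>] succ less_osucc by auto
      then show ?thesis by (auto simp: succ tree_deriv_succ tree_derived_def)
    next
      case limit
      then show ?thesis using lt by (auto simp: tree_deriv_limit)
    qed
  qed simp
qed

lemma is_tree_tree_deriv:
  assumes "is_tree T" shows "is_tree (tree_deriv T \<xi>)"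
proof (induction \<xi> rule: less_induct)
  case (less \<xi>)
  show ?case
  proof (cases \<xi> rule: ctbl_ord_cases)
    case zero
    then show ?thesis using assms by (simp add: tree_deriv_zero)
  next
    case (succ \<eta>)
    then have "is_tree (tree_deriv T \<eta>)" using less less_osucc by blast
    then show ?thesis
      unfolding succ tree_deriv_succ is_tree_def tree_derived_def
      by (auto intro: prefix_order.le_less_trans)
  next
    case limit
    then show ?thesis using less by (auto simp: tree_deriv_limit is_tree_def)
  qed
qed

text \<open>
  A map that respects proper extension cannot lower the order of a tree.
\<close>

lemma tree_deriv_image:
  assumes "\<And>s. s \<in> T \<Longrightarrow> f s \<in> V"
    and "\<And>s t. s \<in> T \<Longrightarrow> t \<in> T \<Longrightarrow> strict_prefix s t \<Longrightarrow> strict_prefix (f s) (f t)"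
  shows "s \<in> tree_deriv T \<xi> \<Longrightarrow> f s \<in> tree_deriv V \<xi>"
proof (induction \<xi> arbitrary: s rule: less_induct)
  case (less \<xi>)
  show ?case
  proof (cases \<xi> rule: ctbl_ord_cases)
    case zero
    then show ?thesis using assms(1) less.prems by (simp add: tree_deriv_zero)
  next
    case (succ \<eta>)
    then obtain t where t: "t \<in> tree_deriv T \<eta>" "strict_prefix s t" and s: "s \<in> tree_deriv T \<eta>"
      using less.prems by (auto simp: tree_deriv_succ tree_derived_def)
    moreover have "tree_deriv T \<eta> \<subseteq> T"
      using tree_deriv_antimono[OF ozero_le, of T \<eta>] by (simp add: tree_deriv_zero)
    ultimately have "strict_prefix (f s) (f t)" using assms(2) by blast
    moreover have "f s \<in> tree_deriv V \<eta>" "f t \<in> tree_deriv V \<eta>"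
      using less.IH[of \<eta>] s t succ less_osucc by auto
    ultimately show ?thesis by (auto simp: succ tree_deriv_succ tree_derived_def)
  next
    case limit
    then show ?thesis using less by (auto simp: tree_deriv_limit)
  qed
qed

lemma countable_ctbl_ord_bounded:
  fixes g :: "'i \<Rightarrow> ctbl_ord"
  assumes "countable I"
  obtains \<beta> where "\<And>i. i \<in> I \<Longrightarrow> g i \<le> \<beta>"
proof -
  have "countable (\<Union>i\<in>I. {\<zeta>. \<zeta> < g i})"
    using assms countable_below by blast
  then obtain \<beta> where "\<beta> \<notin> (\<Union>i\<in>I. {\<zeta>. \<zeta> < g i})"
    using uncountable_ctbl_ord by (metis UNIV_eq_I)
  then show thesis using that[of \<beta>] by (auto simp: not_less)
qed


section \<open>Infinite branches of closed trees\<close>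

text \<open>
  The induction step of the search for a branch.  A node of \<open>P\<close> in the derivative of order
  \<open>\<xi> + 1\<close> has a one-step extension in the derivative of order \<open>\<xi>\<close>.  Balls of radius \<open>\<epsilon> / 2\<close> around
  the points of a countable dense set split these extensions into countably many pieces.  If each
  piece missed some derivative, one countable ordinal would bound all of the stages at which a
  piece is lost, and beyond it no extension would be left.
\<close>

lemma refine_persistent_set:
  fixes V :: "'a::metric_space list set"
  assumes sep: "separable_space (euclidean :: 'a topology)" and tree: "is_tree V"
    and P: "\<And>\<xi>. P \<inter> tree_deriv V \<xi> \<noteq> {}" "P \<subseteq> {s. length s = n}" and \<epsilon>: "\<epsilon> > 0"
  obtains P' where "\<And>\<xi>. P' \<inter> tree_deriv V \<xi> \<noteq> {}"
    "P' \<subseteq> {s. length s = Suc n \<and> take n s \<in> P}"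
    "\<And>s t i. s \<in> P' \<Longrightarrow> t \<in> P' \<Longrightarrow> i \<le> n \<Longrightarrow> dist (s ! i) (t ! i) < \<epsilon>"
proof -
  obtain Q :: "'a set" where Q: "countable Q" "closure Q = UNIV"
    using sep by (auto simp: separable_space_def)
  define piece where "piece q = {s. length s = Suc n \<and> take n s \<in> P \<and>
      (\<forall>i\<le>n. dist (s ! i) (q ! i) < \<epsilon> / 2)}" for q
  define I where "I = {q. set q \<subseteq> Q \<and> length q = Suc n}"
  have "countable I"
    unfolding I_def by (rule countable_subset[OF _ countable_lists[OF Q(1)]]) auto
  have "\<exists>q\<in>I. \<forall>\<xi>. piece q \<inter> tree_deriv V \<xi> \<noteq> {}"
  proof (rule ccontr)
    assume "\<not> ?thesis"
    then have "\<forall>q\<in>I. \<exists>\<xi>. piece q \<inter> tree_deriv V \<xi> = {}" by blast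
    then obtain g where g: "\<And>q. q \<in> I \<Longrightarrow> piece q \<inter> tree_deriv V (g q) = {}" by metis
    obtain \<beta> where \<beta>: "\<And>q. q \<in> I \<Longrightarrow> g q \<le> \<beta>"
      using countable_ctbl_ord_bounded[OF \<open>countable I\<close>] by blast
    obtain s where "s \<in> P" "s \<in> tree_deriv V (osucc \<beta>)" using P(1) by blast
    then obtain t where t: "t \<in> tree_deriv V \<beta>" "strict_prefix s t"
      by (auto simp: tree_deriv_succ tree_derived_def)
    define t' where "t' = take (Suc n) t"
    have "length s = n" using P(2) \<open>s \<in> P\<close> by auto
    then have len: "length t' = Suc n"
      using prefix_length_less[OF t(2)] by (simp add: t'_def)
    have "take n t' = s"
      using t(2) \<open>length s = n\<close> by (auto simp: t'_def strict_prefix_def prefix_def)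
    have t'V: "t' \<in> tree_deriv V \<beta>"
      using is_tree_tree_deriv[OF tree, of \<beta>] t(1) take_is_prefix
      unfolding is_tree_def t'_def by blast
    have "\<exists>p\<in>Q. dist p x < \<epsilon> / 2" for x
      using Q(2) \<epsilon> half_gt_zero closure_approachable[of x Q] by (metis UNIV_I)
    then obtain h where h: "\<And>x. h x \<in> Q" "\<And>x. dist (h x) x < \<epsilon> / 2" by metis
    have "map h t' \<in> I" using h len by (auto simp: I_def)
    moreover have "t' \<in> piece (map h t')"
      using len h \<open>s \<in> P\<close> \<open>take n t' = s\<close> by (auto simp: piece_def dist_commute)
    moreover have "t' \<in> tree_deriv V (g (map h t'))"
      using t'V tree_deriv_antimono[OF \<beta>[OF \<open>map h t' \<in> I\<close>]] by blast
    ultimately show False using g by blast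
  qed
  then obtain q where q: "\<And>\<xi>. piece q \<inter> tree_deriv V \<xi> \<noteq> {}" by blast
  show thesis
  proof (rule that[OF q])
    show "piece q \<subseteq> {s. length s = Suc n \<and> take n s \<in> P}" by (auto simp: piece_def)
    fix s t i assume "s \<in> piece q" "t \<in> piece q" "i \<le> n"
    then have "dist (s ! i) (q ! i) < \<epsilon> / 2" "dist (t ! i) (q ! i) < \<epsilon> / 2"
      by (auto simp: piece_def)
    then show "dist (s ! i) (t ! i) < \<epsilon>" by (rule dist_triangle_half_l)
  qed
qed

text \<open>
  A boundedness theorem for closed trees on Polish spaces, in the spirit of Kunen and Martin.
  The coordinates of the points of the refined sets form Cauchy sequences, so completeness of the
  space and closedness of the levels of the tree give a branch in the limit.
\<close>

lemma closed_tree_infinite_branch: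
  fixes V :: "'a::complete_space list set"
  assumes sep: "separable_space (euclidean :: 'a topology)" and tree: "is_tree V"
    and ord: "tree_order V = Omega1"
    and closed: "\<And>n s l. (\<And>k. map (s k) [0..<n] \<in> V) \<Longrightarrow>
       (\<And>i. i < n \<Longrightarrow> (\<lambda>k. s k i) \<longlonglongrightarrow> l i) \<Longrightarrow> map l [0..<n] \<in> V"
  obtains x where "\<And>n. map x [0..<n] \<in> V"
proof -
  define good where "good n P \<longleftrightarrow> (\<forall>\<xi>. P \<inter> tree_deriv V \<xi> \<noteq> {}) \<and> P \<subseteq> {s. length s = n}" for n P
  define refines where "refines n P P' \<longleftrightarrow> P' \<subseteq> {s. length s = Suc n \<and> take n s \<in> P} \<and>
      (\<forall>s\<in>P'. \<forall>t\<in>P'. \<forall>i\<le>n. dist (s ! i) (t ! i) < (1 / 2) ^ n)" for n and P P' :: "'a list set"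
  have "\<exists>P. \<forall>n. good n (P n) \<and> refines n (P n) (P (Suc n))"
  proof (rule dependent_nat_choice)
    have "[] \<in> tree_deriv V \<xi>" for \<xi>
      using is_tree_tree_deriv[OF tree, of \<xi>] ord
      unfolding tree_order_Omega1_iff is_tree_def by (metis Nil_prefix all_not_in_conv)
    then show "\<exists>P. good 0 P" by (intro exI[of _ "{[]}"]) (auto simp: good_def)
  next
    fix P n assume "good n P"
    then have "\<And>\<xi>. P \<inter> tree_deriv V \<xi> \<noteq> {}" "P \<subseteq> {s. length s = n}" by (auto simp: good_def)
    from refine_persistent_set[OF sep tree this, of "(1 / 2) ^ n"]
    obtain P' where P': "\<And>\<xi>. P' \<inter> tree_deriv V \<xi> \<noteq> {}"
      "P' \<subseteq> {s. length s = Suc n \<and> take n s \<in> P}"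
      "\<And>s t i. s \<in> P' \<Longrightarrow> t \<in> P' \<Longrightarrow> i \<le> n \<Longrightarrow> dist (s ! i) (t ! i) < (1 / 2) ^ n"
      by auto
    then have "good (Suc n) P'" unfolding good_def by blast
    moreover have "refines n P P'" using P' by (simp add: refines_def)
    ultimately show "\<exists>P'. good (Suc n) P' \<and> refines n P P'" by blast
  qed
  then obtain P where good: "\<And>n. good n (P n)" and ref: "\<And>n. refines n (P n) (P (Suc n))"
    by blast
  have "\<exists>s. s \<in> P n \<and> s \<in> V" for n
    using good[of n] unfolding good_def by (metis disjoint_iff tree_deriv_zero)
  then obtain s where s: "\<And>n. s n \<in> P n" "\<And>n. s n \<in> V" by metis
  have len: "length t = n" if "t \<in> P n" for t n
    using good[of n] that by (auto simp: good_def)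
  have take: "take m t \<in> P m" if "t \<in> P (m + j)" for m j t
    using that
  proof (induction j arbitrary: t)
    case 0
    then show ?case using len by fastforce
  next
    case (Suc j)
    then have "take (m + j) t \<in> P (m + j)"
      using ref[of "m + j"] by (auto simp: refines_def)
    from Suc.IH[OF this] show ?case by simp
  qed
  have "Cauchy (\<lambda>n. s n ! i)" for i
  proof (rule metric_CauchyI)
    fix e :: real assume "e > 0"
    then obtain N where N: "(1 / 2) ^ N < e" using real_arch_pow_inv[of e "1 / 2"] by auto
    define m where "m = Suc (max N i)"
    have "dist (s k ! i) (s l ! i) < e" if "k \<ge> m" "l \<ge> m" for k l
    proof -
      have "take m (s k) \<in> P m" "take m (s l) \<in> P m"
        using take[of "s k" m "k - m"] take[of "s l" m "l - m"] s that by auto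
      then have "dist (take m (s k) ! i) (take m (s l) ! i) < (1 / 2) ^ max N i"
        using ref[of "max N i"] unfolding refines_def m_def by (meson max.cobounded2)
      also have "\<dots> \<le> (1 / 2) ^ N" by (rule power_decreasing) auto
      finally show ?thesis using N by (simp add: m_def)
    qed
    then show "\<exists>M. \<forall>k\<ge>M. \<forall>l\<ge>M. dist (s k ! i) (s l ! i) < e" by blast
  qed
  then have "\<exists>l. (\<lambda>n. s n ! i) \<longlonglongrightarrow> l" for i
    by (metis Cauchy_convergent convergent_def)
  then obtain x where x: "\<And>i. (\<lambda>n. s n ! i) \<longlonglongrightarrow> x i" by metis
  show thesis
  proof (rule that, rule closed[where s = "\<lambda>k i. s (k + n) ! i" for n])
    fix n k
    have "map (\<lambda>i. s (k + n) ! i) [0..<n] = take n (s (k + n))"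
      using len[OF s(1)] by (intro nth_equalityI) auto
    then show "map (\<lambda>i. s (k + n) ! i) [0..<n] \<in> V"
      using tree s(2)[of "k + n"] take_is_prefix unfolding is_tree_def by metis
  next
    fix n i show "(\<lambda>k. s (k + n) ! i) \<longlonglongrightarrow> x i"
      using x[of i] by (rule LIMSEQ_ignore_initial_segment)
  qed
qed


section \<open>Unconditional bases and the norm of the direct sum\<close>

lemma (in normed_space_over) tendsto_scale:
  assumes "f \<longlonglongrightarrow> l" shows "(\<lambda>k. scale c (f k)) \<longlonglongrightarrow> scale c l"
proof -
  have "(\<lambda>k. norm c * norm (f k - l)) \<longlonglongrightarrow> norm c * 0"
    using assms by (intro tendsto_mult tendsto_const) (simp add: tendsto_norm_zero_iff LIM_zero_iff)
  then have "(\<lambda>k. norm (scale c (f k) - scale c l)) \<longlonglongrightarrow> 0"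
    by (simp add: norm_scale flip: scale_right_diff_distrib)
  then show ?thesis by (simp add: tendsto_norm_zero_iff LIM_zero_iff)
qed

lemma (in normed_space_over) unconditional_flip:
  assumes "one_unconditional_basis scale z" and "\<And>i. i < n \<Longrightarrow> \<epsilon> i \<in> {1, -1 :: real}"
  shows "norm (\<Sum>i<n. (\<epsilon> i * a i) *\<^sub>R z i) \<le> norm (\<Sum>i<n. a i *\<^sub>R z i)"
proof -
  have "norm (\<Sum>i<n. scale (of_real (\<epsilon> i) * of_real (a i)) (z i))
      \<le> norm (\<Sum>i<n. scale (of_real (a i)) (z i))"
    using assms(1) unfolding one_unconditional_basis_def
    by (elim conjE allE[where x = n] allE[where x = "\<lambda>i. of_real (\<epsilon> i)"]
        allE[where x = "\<lambda>i. of_real (a i)"] impE) (use assms(2) in force)+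
  then show ?thesis by (simp only: scale_of_real flip: of_real_mult)
qed

text \<open>
  Enlarging one coefficient at a time: as a function of a single coefficient the norm is convex
  and even, hence increasing in the modulus.
\<close>

lemma (in normed_space_over) unconditional_mono:
  assumes ub: "one_unconditional_basis scale z" and le: "\<And>i. i < n \<Longrightarrow> \<bar>a i\<bar> \<le> b i"
  shows "norm (\<Sum>i<n. a i *\<^sub>R z i) \<le> norm (\<Sum>i<n. b i *\<^sub>R z i)"
proof -
  define c where "c k i = (if i < k then b i else a i)" for k i
  have "norm (\<Sum>i<n. a i *\<^sub>R z i) \<le> norm (\<Sum>i<n. c k i *\<^sub>R z i)" if "k \<le> n" for k
    using that
  proof (induction k)
    case 0
    show ?case by (simp add: c_def)
  next
    case (Suc k)
    define \<epsilon> where "\<epsilon> i = (if i = k then -1 else 1 :: real)" for i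
    define u where "u = (\<Sum>i<n. c (Suc k) i *\<^sub>R z i)"
    define v where "v = (\<Sum>i<n. (\<epsilon> i * c (Suc k) i) *\<^sub>R z i)"
    have vu: "norm v \<le> norm u"
      unfolding u_def v_def by (rule unconditional_flip[OF ub]) (simp add: \<epsilon>_def)
    have "\<bar>a k\<bar> \<le> b k" using le Suc.prems by simp
    (* The old coefficient is a convex combination of b k and - b k; for b k = 0 any weight does. *)
    define t where "t = (if b k = 0 then 1 / 2 else (1 + a k / b k) / 2)"
    have t: "0 \<le> t" "t \<le> 1" "a k = t * b k + (1 - t) * (- b k)"
      using \<open>\<bar>a k\<bar> \<le> b k\<close> by (auto simp: t_def field_simps abs_le_iff)
    have "(\<Sum>i<n. c k i *\<^sub>R z i) = t *\<^sub>R u + (1 - t) *\<^sub>R v"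
    proof -
      have "c k i = t * c (Suc k) i + (1 - t) * (\<epsilon> i * c (Suc k) i)" for i
        using t(3) by (cases "i = k") (auto simp: c_def \<epsilon>_def algebra_simps)
      then show ?thesis
        unfolding u_def v_def
        by (simp only: scaleR_sum_right scaleR_scaleR flip: sum.distrib scaleR_add_left)
    qed
    then have "norm (\<Sum>i<n. c k i *\<^sub>R z i) \<le> t * norm u + (1 - t) * norm v"
      using t norm_triangle_ineq[of "t *\<^sub>R u" "(1 - t) *\<^sub>R v"] by simp
    also have "\<dots> \<le> t * norm u + (1 - t) * norm u"
      using t vu by (intro add_mono mult_left_mono) auto
    finally have "norm (\<Sum>i<n. c k i *\<^sub>R z i) \<le> norm u" by (simp add: algebra_simps)
    then show ?case using Suc by (simp add: u_def)
  qed
  from this[of n] show ?thesis by (simp add: c_def)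
qed


locale direct_sum_setting =
  Zs: normed_space_over sZ + Ys: normed_space_over sY
  for sZ :: "'f::{real_normed_field,euclidean_space} \<Rightarrow> 'z::banach \<Rightarrow> 'z"
    and sY :: "'f \<Rightarrow> 'y::real_normed_vector \<Rightarrow> 'y" +
  fixes z :: "nat \<Rightarrow> 'z" and Y :: "nat \<Rightarrow> 'y set"
  assumes unconditional: "one_unconditional_basis sZ z"
    and subspace_Y: "\<And>n. Ys.subspace (Y n)"
begin

lemma summable_mono_coeff:
  assumes le: "\<And>i. \<bar>a i\<bar> \<le> b i" and sm: "summable (\<lambda>i. b i *\<^sub>R z i)"
  shows "summable (\<lambda>i. a i *\<^sub>R z i)"
  unfolding summable_Cauchy
proof (intro allI impI)
  fix e :: real assume "e > 0"
  then obtain N where N: "\<And>m n. m \<ge> N \<Longrightarrow> norm (\<Sum>i\<in>{m..<n}. b i *\<^sub>R z i) < e"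
    using sm unfolding summable_Cauchy by blast
  have block: "(\<Sum>i\<in>{m..<n}. c i *\<^sub>R z i) = (\<Sum>i<n. (if i < m then 0 else c i) *\<^sub>R z i)"
    for c :: "nat \<Rightarrow> real" and m n
    by (rule sum.mono_neutral_cong_left) auto
  have "norm (\<Sum>i\<in>{m..<n}. a i *\<^sub>R z i) \<le> norm (\<Sum>i\<in>{m..<n}. b i *\<^sub>R z i)" for m n
    unfolding block by (rule Zs.unconditional_mono[OF unconditional]) (use le in auto)
  then show "\<exists>N. \<forall>m\<ge>N. \<forall>n. norm (\<Sum>i\<in>{m..<n}. a i *\<^sub>R z i) < e"
    using N by (meson le_less_trans)
qed

lemma norm_suminf_mono_coeff:
  assumes le: "\<And>i. \<bar>a i\<bar> \<le> b i" and sm: "summable (\<lambda>i. b i *\<^sub>R z i)"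
  shows "norm (\<Sum>i. a i *\<^sub>R z i) \<le> norm (\<Sum>i. b i *\<^sub>R z i)"
proof (rule LIMSEQ_le)
  show "(\<lambda>n. norm (\<Sum>i<n. a i *\<^sub>R z i)) \<longlonglongrightarrow> norm (\<Sum>i. a i *\<^sub>R z i)"
    by (intro tendsto_norm summable_LIMSEQ summable_mono_coeff[OF le sm])
  show "(\<lambda>n. norm (\<Sum>i<n. b i *\<^sub>R z i)) \<longlonglongrightarrow> norm (\<Sum>i. b i *\<^sub>R z i)"
    by (intro tendsto_norm summable_LIMSEQ sm)
  show "\<exists>N. \<forall>n\<ge>N. norm (\<Sum>i<n. a i *\<^sub>R z i) \<le> norm (\<Sum>i<n. b i *\<^sub>R z i)"
    using Zs.unconditional_mono[OF unconditional, of _ a b] le by blast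
qed

text \<open>
  Sums, differences and the triangle inequality in all its forms are instances of this bound.
\<close>

lemma YZ_dominated:
  assumes u: "u \<in> YZ Y z" and v: "v \<in> YZ Y z" and w: "\<And>n. w n \<in> Y n"
    and le: "\<And>n. norm (w n) \<le> norm (u n) + norm (v n)"
  shows "w \<in> YZ Y z" and "YZ_norm z w \<le> YZ_norm z u + YZ_norm z v"
proof -
  have su: "summable (\<lambda>n. norm (u n) *\<^sub>R z n)" and sv: "summable (\<lambda>n. norm (v n) *\<^sub>R z n)"
    using u v by (auto simp: YZ_def)
  have sum: "summable (\<lambda>n. (norm (u n) + norm (v n)) *\<^sub>R z n)"
    using summable_add[OF su sv] by (simp add: scaleR_add_left)
  have le': "\<bar>norm (w n)\<bar> \<le> norm (u n) + norm (v n)" for n using le by simp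
  show "w \<in> YZ Y z" using w summable_mono_coeff[OF le' sum] by (simp add: YZ_def)
  have "YZ_norm z w \<le> norm (\<Sum>n. (norm (u n) + norm (v n)) *\<^sub>R z n)"
    unfolding YZ_norm_def by (rule norm_suminf_mono_coeff[OF le' sum])
  also have "\<dots> = norm ((\<Sum>n. norm (u n) *\<^sub>R z n) + (\<Sum>n. norm (v n) *\<^sub>R z n))"
    by (simp add: scaleR_add_left suminf_add[OF su sv])
  finally show "YZ_norm z w \<le> YZ_norm z u + YZ_norm z v"
    unfolding YZ_norm_def using norm_triangle_ineq order_trans by blast
qed

lemma norm_YZ_norm: "norm (YZ_norm z u) = YZ_norm z u"
  by (simp add: YZ_norm_def)

lemma YZ_coord: "u \<in> YZ Y z \<Longrightarrow> u n \<in> Y n"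
  by (simp add: YZ_def)

lemma YZ_add:
  assumes "u \<in> YZ Y z" "v \<in> YZ Y z"
  shows "(\<lambda>n. u n + v n) \<in> YZ Y z"
    and "YZ_norm z (\<lambda>n. u n + v n) \<le> YZ_norm z u + YZ_norm z v"
  by (rule YZ_dominated[OF assms];
      use Ys.subspace_add[OF subspace_Y] YZ_coord assms norm_triangle_ineq in blast)+

lemma YZ_diff:
  assumes "u \<in> YZ Y z" "v \<in> YZ Y z"
  shows "(\<lambda>n. u n - v n) \<in> YZ Y z"
    and "YZ_norm z (\<lambda>n. u n - v n) \<le> YZ_norm z u + YZ_norm z v"
  by (rule YZ_dominated[OF assms];
      use Ys.subspace_diff[OF subspace_Y] YZ_coord assms norm_triangle_ineq4 in blast)+

lemma YZ_scale:
  assumes "u \<in> YZ Y z"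
  shows "(\<lambda>n. sY c (u n)) \<in> YZ Y z"
    and "YZ_norm z (\<lambda>n. sY c (u n)) = norm c * YZ_norm z u"
proof -
  have sm: "summable (\<lambda>n. norm (u n) *\<^sub>R z n)" using assms by (simp add: YZ_def)
  have eq: "norm (sY c (u n)) *\<^sub>R z n = norm c *\<^sub>R (norm (u n) *\<^sub>R z n)" for n
    by (simp add: Ys.norm_scale)
  show "(\<lambda>n. sY c (u n)) \<in> YZ Y z"
    using assms Ys.subspace_scale[OF subspace_Y] summable_scaleR_right[OF sm, of "norm c"]
    by (simp add: YZ_def eq)
  show "YZ_norm z (\<lambda>n. sY c (u n)) = norm c * YZ_norm z u"
    unfolding YZ_norm_def eq suminf_scaleR_right[OF sm, symmetric] by simp
qed

lemma YZ_finite_support: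
  assumes "\<And>n. u n \<in> Y n" "\<And>n. n \<ge> N \<Longrightarrow> u n = 0"
  shows "u \<in> YZ Y z" and "YZ_norm z u = norm (\<Sum>n<N. norm (u n) *\<^sub>R z n)"
proof -
  have z: "norm (u n) *\<^sub>R z n = 0" if "n \<notin> {..<N}" for n using assms(2) that by simp
  show "u \<in> YZ Y z"
    using assms(1) summable_finite[of "{..<N}" "\<lambda>n. norm (u n) *\<^sub>R z n"] z by (simp add: YZ_def)
  show "YZ_norm z u = norm (\<Sum>n<N. norm (u n) *\<^sub>R z n)"
    unfolding YZ_norm_def using suminf_finite[of "{..<N}" "\<lambda>n. norm (u n) *\<^sub>R z n"] z by simp
qed

lemma YZ_zero: "(\<lambda>n. 0) \<in> YZ Y z" "YZ_norm z (\<lambda>n. 0 :: 'y) = 0"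
  using YZ_finite_support[of "\<lambda>n. 0" 0] Ys.subspace_0[OF subspace_Y] by auto

lemma YZ_coord_embed:
  assumes "w \<in> Y i"
  shows "coord_embed i w \<in> YZ Y z" and "YZ_norm z (coord_embed i w) = norm w * norm (z i)"
proof -
  have mem: "coord_embed i w n \<in> Y n" and supp: "n \<ge> Suc i \<Longrightarrow> coord_embed i w n = 0" for n
    using assms Ys.subspace_0[OF subspace_Y] by (auto simp: coord_embed_def)
  show "coord_embed i w \<in> YZ Y z" by (rule YZ_finite_support(1)[OF mem supp])
  have "YZ_norm z (coord_embed i w) = norm (\<Sum>n<Suc i. norm (coord_embed i w n) *\<^sub>R z n)"
    by (rule YZ_finite_support(2)[OF mem supp])
  then show "YZ_norm z (coord_embed i w) = norm w * norm (z i)"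
    by (simp add: coord_embed_def)
qed

text \<open>Expansions with respect to the basis \<open>z\<close> are unique.\<close>

lemma YZ_norm_eq_0D:
  assumes u: "u \<in> YZ Y z" and "YZ_norm z u = 0"
  shows "u n = 0"
proof -
  have "(\<lambda>n. norm (u n) *\<^sub>R z n) sums 0"
    using assms summable_sums unfolding YZ_def YZ_norm_def by fastforce
  then have a: "(\<lambda>n. sZ (of_real (norm (u n))) (z n)) sums 0" by (simp only: Zs.scale_of_real)
  have b: "(\<lambda>n. sZ 0 (z n)) sums 0" by simp
  have ex: "\<exists>!a. (\<lambda>n. sZ (a n) (z n)) sums 0"
    using unconditional by (simp add: one_unconditional_basis_def schauder_basis_def)
  have "(\<lambda>n. of_real (norm (u n)) :: 'f) = (\<lambda>n. 0)"
    using the1_equality[OF ex, of "\<lambda>n. of_real (norm (u n))"] the1_equality[OF ex, of "\<lambda>n. 0"] a b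
    by (simp only:)
  then show ?thesis by (metis norm_eq_zero of_real_eq_0_iff)
qed

lemma YZ_tail_tendsto_0:
  assumes u: "u \<in> YZ Y z"
  shows "(\<lambda>N. YZ_norm z (\<lambda>n. if n < N then 0 else u n)) \<longlonglongrightarrow> 0"
proof -
  let ?f = "\<lambda>n. norm (u n) *\<^sub>R z n"
  have sm: "summable ?f" using u by (simp add: YZ_def)
  have "YZ_norm z (\<lambda>n. if n < N then 0 else u n) = norm (suminf ?f - sum ?f {..<N})" for N
  proof -
    have "(\<lambda>n. ?f n - (if n \<in> {..<N} then ?f n else 0)) sums (suminf ?f - sum ?f {..<N})"
      by (intro sums_diff summable_sums[OF sm] sums_If_finite_set) simp
    moreover have "?f n - (if n \<in> {..<N} then ?f n else 0)
        = norm (if n < N then 0 else u n) *\<^sub>R z n" for n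
      by simp
    ultimately show ?thesis
      unfolding YZ_norm_def by (simp only: sums_unique[symmetric])
  qed
  moreover have "(\<lambda>N. norm (suminf ?f - sum ?f {..<N})) \<longlonglongrightarrow> norm (suminf ?f - suminf ?f)"
    by (intro tendsto_intros summable_LIMSEQ[OF sm])
  ultimately show ?thesis by simp
qed

end


section \<open>Embedding the direct sum along an infinite branch\<close>

locale equivalent_sequences = direct_sum_setting sZ sY z Y + Xs: normed_space_over sX
  for sZ :: "'f::{real_normed_field,euclidean_space} \<Rightarrow> 'z::banach \<Rightarrow> 'z"
    and sY :: "'f \<Rightarrow> 'y::real_normed_vector \<Rightarrow> 'y" and z Y
    and sX :: "'f \<Rightarrow> 'x::banach \<Rightarrow> 'x" +
  fixes x :: "nat \<Rightarrow> 'x" and y :: "nat \<Rightarrow> nat \<Rightarrow> 'y" and D :: real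
  assumes branch: "\<And>n. map x [0..<n] \<in> vector_tree sY z sX D y"
    and y_coord: "\<And>k. y k \<in> (\<Union>i. coord_embed i ` Y i)"
    and y_dense: "\<And>i v e. v \<in> Y i \<Longrightarrow> e > 0 \<Longrightarrow> \<exists>k w. w \<in> Y i \<and> y k = coord_embed i w \<and> norm (v - w) < e"
begin

text \<open>
  The operator \<open>y\<^sub>k \<mapsto> x\<^sub>k\<close> on the span is used as a relation, so that well-definedness comes from the
  bounds below and not from a choice of coefficients.  Quantifying over all large \<open>N\<close> forces \<open>a\<close> to
  contribute nothing from some index on; combinations of different lengths can then be added
  without padding.
\<close>

definition comb :: "(nat \<Rightarrow> 'y) \<Rightarrow> 'x \<Rightarrow> bool"
  where "comb f g \<longleftrightarrow> (\<exists>a. \<forall>\<^sub>F N in sequentially.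
    f = (\<lambda>m. \<Sum>k<N. sY (a k) (y k m)) \<and> g = (\<Sum>k<N. sX (a k) (x k)))"

lemma comb_add:
  assumes "comb f g" "comb f' g'"
  shows "comb (\<lambda>m. f m + f' m) (g + g')"
proof -
  obtain a a' where
    a: "\<forall>\<^sub>F N in sequentially. f = (\<lambda>m. \<Sum>k<N. sY (a k) (y k m)) \<and> g = (\<Sum>k<N. sX (a k) (x k))"
    and a': "\<forall>\<^sub>F N in sequentially. f' = (\<lambda>m. \<Sum>k<N. sY (a' k) (y k m)) \<and> g' = (\<Sum>k<N. sX (a' k) (x k))"
    using assms unfolding comb_def by blast
  have "\<forall>\<^sub>F N in sequentially. (\<lambda>m. f m + f' m) = (\<lambda>m. \<Sum>k<N. sY (a k + a' k) (y k m))
      \<and> g + g' = (\<Sum>k<N. sX (a k + a' k) (x k))"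
    using a a' by eventually_elim
      (simp add: Ys.scale_left_distrib Xs.scale_left_distrib sum.distrib)
  then show ?thesis unfolding comb_def by (intro exI[of _ "\<lambda>k. a k + a' k"])
qed

lemma comb_scale:
  assumes "comb f g" shows "comb (\<lambda>m. sY c (f m)) (sX c g)"
proof -
  obtain a where
    a: "\<forall>\<^sub>F N in sequentially. f = (\<lambda>m. \<Sum>k<N. sY (a k) (y k m)) \<and> g = (\<Sum>k<N. sX (a k) (x k))"
    using assms unfolding comb_def by blast
  have "\<forall>\<^sub>F N in sequentially. (\<lambda>m. sY c (f m)) = (\<lambda>m. \<Sum>k<N. sY (c * a k) (y k m))
      \<and> sX c g = (\<Sum>k<N. sX (c * a k) (x k))"
    using a by eventually_elim (simp add: Ys.scale_sum_right Xs.scale_sum_right)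
  then show ?thesis unfolding comb_def by (intro exI[of _ "\<lambda>k. c * a k"])
qed

lemma comb_diff:
  assumes "comb f g" "comb f' g'" shows "comb (\<lambda>m. f m - f' m) (g - g')"
  using comb_add[OF assms(1) comb_scale[OF assms(2), of "-1"]] by simp

lemma comb_zero: "comb (\<lambda>m. 0) 0"
  unfolding comb_def by (intro exI[of _ "\<lambda>k. 0"]) simp

lemma comb_generator: "comb (y k) (x k)"
proof -
  let ?a = "\<lambda>j. if j = k then 1 else 0 :: 'f"
  have "(\<Sum>j<N. sY (?a j) (y j m)) = y k m" "(\<Sum>j<N. sX (?a j) (x j)) = x k" if "N > k" for N m
  proof -
    have "(\<Sum>j<N. sY (?a j) (y j m)) = (\<Sum>j<N. if j = k then y j m else 0)"
      "(\<Sum>j<N. sX (?a j) (x j)) = (\<Sum>j<N. if j = k then x j else 0)"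
      by (intro sum.cong; simp)+
    then show "(\<Sum>j<N. sY (?a j) (y j m)) = y k m" "(\<Sum>j<N. sX (?a j) (x j)) = x k"
      using that by auto
  qed
  then show ?thesis
    unfolding comb_def
    by (intro exI[of _ ?a] eventually_mono[OF eventually_gt_at_top[of k]]) simp
qed

lemma y_in_YZ: "y k \<in> YZ Y z"
  using y_coord[of k] YZ_coord_embed(1) by auto

lemma comb_in_YZ:
  assumes "comb f g" shows "f \<in> YZ Y z"
proof -
  obtain a N where f: "f = (\<lambda>m. \<Sum>k<N. sY (a k) (y k m))"
    using assms unfolding comb_def by (auto dest: eventually_happens)
  have "(\<lambda>m. \<Sum>k<n. sY (a k) (y k m)) \<in> YZ Y z" for n
    by (induction n) (auto simp: YZ_zero intro!: YZ_add(1) YZ_scale(1) y_in_YZ)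
  then show ?thesis by (simp add: f)
qed

lemma comb_bounds:
  assumes "comb f g" shows "norm g \<le> YZ_norm z f" and "YZ_norm z f \<le> D * norm g"
proof -
  obtain a N where f: "f = (\<lambda>m. \<Sum>k<N. sY (a k) (y k m))" and g: "g = (\<Sum>k<N. sX (a k) (x k))"
    using assms unfolding comb_def by (auto dest: eventually_happens)
  show "norm g \<le> YZ_norm z f" and "YZ_norm z f \<le> D * norm g"
    using branch[of N] unfolding f g vector_tree_def by simp_all
qed

text \<open>
  The coordinates of the approximated vector are treated one after another; the remaining
  tail is small.
\<close>

lemma comb_dense:
  assumes u: "u \<in> YZ Y z" and "e > 0"
  shows "\<exists>f g. comb f g \<and> YZ_norm z (\<lambda>n. u n - f n) < e"
proof -
  let ?head = "\<lambda>N n. if n < N then u n else 0" and ?tail = "\<lambda>N n. if n < N then 0 else u n"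
  have uY: "u n \<in> Y n" for n by (rule YZ_coord[OF u])
  have head_in: "?head N \<in> YZ Y z" for N
    by (rule YZ_finite_support(1)[of _ N]) (use uY Ys.subspace_0[OF subspace_Y] in auto)
  have tail_in: "?tail N \<in> YZ Y z" for N
    by (rule YZ_dominated(1)[OF u u]) (use uY Ys.subspace_0[OF subspace_Y] in auto)
  have head: "\<exists>f g. comb f g \<and> YZ_norm z (\<lambda>n. ?head N n - f n) < d" if "d > 0" for N d
    using that
  proof (induction N arbitrary: d)
    case 0
    then show ?case using comb_zero YZ_zero(2) by (intro exI[of _ "\<lambda>n. 0"] exI[of _ 0]) simp
  next
    case (Suc N)
    obtain f g where fg: "comb f g" "YZ_norm z (\<lambda>n. ?head N n - f n) < d / 2"
      using Suc.IH[of "d / 2"] Suc.prems by auto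
    define \<delta> where "\<delta> = d / 2 / (norm (z N) + 1)"
    have pos: "norm (z N) + 1 > 0" by (rule add_nonneg_pos) auto
    have "\<delta> > 0" using Suc.prems pos by (simp add: \<delta>_def)
    then obtain k w where w: "w \<in> Y N" "y k = coord_embed N w" "norm (u N - w) < \<delta>"
      using y_dense[OF uY] by blast
    have diff: "u N - w \<in> Y N" using uY w(1) by (rule Ys.subspace_diff[OF subspace_Y])
    have "norm (u N - w) * norm (z N) \<le> \<delta> * (norm (z N) + 1)"
      using w(3) \<open>\<delta> > 0\<close> by (intro mult_mono) auto
    also have "\<dots> = d / 2" using pos unfolding \<delta>_def by (intro nonzero_eq_divide_eq[THEN iffD1]) auto
    finally have small: "YZ_norm z (coord_embed N (u N - w)) \<le> d / 2"
      by (simp add: YZ_coord_embed(2)[OF diff])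
    have "(\<lambda>n. ?head (Suc N) n - (f n + y k n))
        = (\<lambda>n. (?head N n - f n) + coord_embed N (u N - w) n)"
      by (auto simp: w(2) coord_embed_def fun_eq_iff)
    then have "YZ_norm z (\<lambda>n. ?head (Suc N) n - (f n + y k n))
        \<le> YZ_norm z (\<lambda>n. ?head N n - f n) + YZ_norm z (coord_embed N (u N - w))"
      using YZ_add(2)[OF YZ_diff(1)[OF head_in comb_in_YZ[OF fg(1)]] YZ_coord_embed(1)[OF diff]]
      by simp
    then have "YZ_norm z (\<lambda>n. ?head (Suc N) n - (f n + y k n)) < d" using fg(2) small by simp
    then show ?case using comb_add[OF fg(1) comb_generator[of k]] by blast
  qed
  have "\<forall>\<^sub>F N in sequentially. YZ_norm z (?tail N) < e / 2"
    using YZ_tail_tendsto_0[OF u] \<open>e > 0\<close> by (intro order_tendstoD) auto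
  then obtain N where N: "YZ_norm z (?tail N) < e / 2" by (auto dest: eventually_happens)
  obtain f g where fg: "comb f g" "YZ_norm z (\<lambda>n. ?head N n - f n) < e / 2"
    using head[OF half_gt_zero[OF \<open>e > 0\<close>], of N] by blast
  have "(\<lambda>n. u n - f n) = (\<lambda>n. (?head N n - f n) + ?tail N n)" by (auto simp: fun_eq_iff)
  then have "YZ_norm z (\<lambda>n. u n - f n) \<le> YZ_norm z (\<lambda>n. ?head N n - f n) + YZ_norm z (?tail N)"
    using YZ_add(2)[OF YZ_diff(1)[OF head_in comb_in_YZ[OF fg(1)]] tail_in] by simp
  then show ?thesis using fg N by (intro exI[of _ f] exI[of _ g]) auto
qed

text \<open>
  The closure of the graph of the operator on the span.  Passing to the limit preserves both bounds,
  so this relation is single-valued and is the graph of the wanted embedding.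
\<close>

definition graph :: "(nat \<Rightarrow> 'y) \<Rightarrow> 'x \<Rightarrow> bool"
  where "graph u v \<longleftrightarrow> (\<exists>f g. (\<forall>k. comb (f k) (g k)) \<and>
    (\<lambda>k. YZ_norm z (\<lambda>n. u n - f k n)) \<longlonglongrightarrow> 0 \<and> g \<longlonglongrightarrow> v)"

lemma graph_bounds:
  assumes u: "u \<in> YZ Y z" and "graph u v"
  shows "norm v \<le> YZ_norm z u" and "YZ_norm z u \<le> D * norm v"
proof -
  obtain f g where fg: "\<And>k. comb (f k) (g k)"
    and f: "(\<lambda>k. YZ_norm z (\<lambda>n. u n - f k n)) \<longlonglongrightarrow> 0" and g: "g \<longlonglongrightarrow> v"
    using assms(2) unfolding graph_def by blast
  have fY: "f k \<in> YZ Y z" for k by (rule comb_in_YZ[OF fg])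
  have diff: "(\<lambda>n. u n - f k n) \<in> YZ Y z" for k by (rule YZ_diff(1)[OF u fY])
  have "norm (g k) \<le> YZ_norm z u + YZ_norm z (\<lambda>n. u n - f k n)" for k
    using comb_bounds(1)[OF fg, of k] YZ_diff(2)[OF u diff, of k] by simp
  moreover have "(\<lambda>k. YZ_norm z u + YZ_norm z (\<lambda>n. u n - f k n)) \<longlonglongrightarrow> YZ_norm z u + 0"
    by (intro tendsto_intros f)
  ultimately show "norm v \<le> YZ_norm z u"
    using LIMSEQ_le[OF tendsto_norm[OF g]] by auto
  have "YZ_norm z u \<le> D * norm (g k) + YZ_norm z (\<lambda>n. u n - f k n)" for k
    using comb_bounds(2)[OF fg, of k] YZ_add(2)[OF fY diff, of k k] by simp
  moreover have "(\<lambda>k. D * norm (g k) + YZ_norm z (\<lambda>n. u n - f k n)) \<longlonglongrightarrow> D * norm v + 0"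
    by (intro tendsto_intros f g)
  ultimately show "YZ_norm z u \<le> D * norm v"
    using LIMSEQ_le_const[of _ "D * norm v + 0"] by auto
qed

lemma graph_add:
  assumes u: "u \<in> YZ Y z" "u' \<in> YZ Y z" and "graph u v" "graph u' v'"
  shows "graph (\<lambda>n. u n + u' n) (v + v')"
proof -
  obtain f g where fg: "\<And>k. comb (f k) (g k)"
    and f: "(\<lambda>k. YZ_norm z (\<lambda>n. u n - f k n)) \<longlonglongrightarrow> 0" and g: "g \<longlonglongrightarrow> v"
    using assms(3) unfolding graph_def by blast
  obtain f' g' where fg': "\<And>k. comb (f' k) (g' k)"
    and f': "(\<lambda>k. YZ_norm z (\<lambda>n. u' n - f' k n)) \<longlonglongrightarrow> 0" and g': "g' \<longlonglongrightarrow> v'"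
    using assms(4) unfolding graph_def by blast
  have le: "norm (YZ_norm z (\<lambda>n. (u n + u' n) - (f k n + f' k n)))
      \<le> YZ_norm z (\<lambda>n. u n - f k n) + YZ_norm z (\<lambda>n. u' n - f' k n)" for k
    using YZ_add(2)[OF YZ_diff(1)[OF u(1) comb_in_YZ[OF fg]]
        YZ_diff(1)[OF u(2) comb_in_YZ[OF fg']], of k k]
    by (simp only: norm_YZ_norm add_diff_add)
  have lim: "(\<lambda>k. YZ_norm z (\<lambda>n. u n - f k n) + YZ_norm z (\<lambda>n. u' n - f' k n)) \<longlonglongrightarrow> 0"
    using tendsto_add[OF f f'] by simp
  have "(\<lambda>k. YZ_norm z (\<lambda>n. (u n + u' n) - (f k n + f' k n))) \<longlonglongrightarrow> 0"
    by (rule Lim_null_comparison[OF always_eventually lim]) (use le in blast)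
  then show ?thesis
    unfolding graph_def using comb_add[OF fg fg'] tendsto_add[OF g g']
    by (intro exI[of _ "\<lambda>k n. f k n + f' k n"] exI[of _ "\<lambda>k. g k + g' k"]) simp
qed

lemma graph_scale:
  assumes u: "u \<in> YZ Y z" and "graph u v"
  shows "graph (\<lambda>n. sY c (u n)) (sX c v)"
proof -
  obtain f g where fg: "\<And>k. comb (f k) (g k)"
    and f: "(\<lambda>k. YZ_norm z (\<lambda>n. u n - f k n)) \<longlonglongrightarrow> 0" and g: "g \<longlonglongrightarrow> v"
    using assms(2) unfolding graph_def by blast
  have "YZ_norm z (\<lambda>n. sY c (u n) - sY c (f k n)) = norm c * YZ_norm z (\<lambda>n. u n - f k n)" for k
    using YZ_scale(2)[OF YZ_diff(1)[OF u comb_in_YZ[OF fg]], of c k]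
    by (simp add: Ys.scale_right_diff_distrib)
  moreover have "(\<lambda>k. norm c * YZ_norm z (\<lambda>n. u n - f k n)) \<longlonglongrightarrow> 0"
    using tendsto_mult[OF tendsto_const f] by simp
  ultimately show ?thesis
    unfolding graph_def using comb_scale[OF fg] Xs.tendsto_scale[OF g]
    by (intro exI[of _ "\<lambda>k n. sY c (f k n)"] exI[of _ "\<lambda>k. sX c (g k)"]) simp
qed

lemma graph_diff:
  assumes "u \<in> YZ Y z" "u' \<in> YZ Y z" and "graph u v" "graph u' v'"
  shows "graph (\<lambda>n. u n - u' n) (v - v')"
  using graph_add[OF assms(1) YZ_scale(1)[OF assms(2)] assms(3) graph_scale[OF assms(2,4)], of "-1"]
  by simp

lemma graph_unique:
  assumes "u \<in> YZ Y z" "graph u v" "graph u v'"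
  shows "v = v'"
  using graph_bounds(1)[OF YZ_diff(1) graph_diff, OF assms(1) assms(1) assms(1) assms(1) assms(2,3)]
    YZ_zero(2) by simp

text \<open>
  Approximating combinations in the span have Cauchy images, because the operator on the span is a
  contraction, and the target space is complete.
\<close>

lemma graph_total:
  assumes u: "u \<in> YZ Y z"
  shows "\<exists>v. graph u v"
proof -
  have "\<exists>f g. comb f g \<and> YZ_norm z (\<lambda>n. u n - f n) < inverse (real (Suc k))" for k
    by (rule comb_dense[OF u]) simp
  then obtain f g where fg: "\<And>k. comb (f k) (g k)"
    and f: "\<And>k. YZ_norm z (\<lambda>n. u n - f k n) < inverse (real (Suc k))"
    by metis
  have f0: "(\<lambda>k. YZ_norm z (\<lambda>n. u n - f k n)) \<longlonglongrightarrow> 0"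
    by (rule Lim_null_comparison[OF always_eventually LIMSEQ_inverse_real_of_nat])
      (use f in \<open>auto simp only: norm_YZ_norm intro: less_imp_le\<close>)
  have "Cauchy g"
  proof (rule metric_CauchyI)
    fix e :: real assume "e > 0"
    then have "\<forall>\<^sub>F k in sequentially. YZ_norm z (\<lambda>n. u n - f k n) < e / 2"
      using f0 by (intro order_tendstoD) auto
    then obtain M where M: "\<And>k. k \<ge> M \<Longrightarrow> YZ_norm z (\<lambda>n. u n - f k n) < e / 2"
      unfolding eventually_sequentially by blast
    have "dist (g k) (g l) < e" if "k \<ge> M" "l \<ge> M" for k l
    proof -
      have "dist (g k) (g l) \<le> YZ_norm z (\<lambda>n. f k n - f l n)"
        unfolding dist_norm by (rule comb_bounds(1)[OF comb_diff[OF fg fg]])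
      also have "\<dots> \<le> YZ_norm z (\<lambda>n. u n - f l n) + YZ_norm z (\<lambda>n. u n - f k n)"
        using YZ_diff(2)[OF YZ_diff(1)[OF u comb_in_YZ[OF fg]] YZ_diff(1)[OF u comb_in_YZ[OF fg]], of l k]
        by simp
      also have "\<dots> < e" using M[OF that(1)] M[OF that(2)] by simp
      finally show ?thesis .
    qed
    then show "\<exists>M. \<forall>k\<ge>M. \<forall>l\<ge>M. dist (g k) (g l) < e" by blast
  qed
  then obtain v where "g \<longlonglongrightarrow> v" by (metis Cauchy_convergent convergent_def)
  then show ?thesis unfolding graph_def using fg f0 by blast
qed

lemma YZ_embeds_of_branch: "YZ_embeds sY Y z sX D"
proof -
  obtain A where A: "\<And>u. u \<in> YZ Y z \<Longrightarrow> graph u (A u)"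
    using graph_total by metis
  have inj: "inj_on A (YZ Y z)"
  proof (rule inj_onI, rule ext)
    fix u v n assume uv: "u \<in> YZ Y z" "v \<in> YZ Y z" "A u = A v"
    have d: "(\<lambda>n. u n - v n) \<in> YZ Y z" by (rule YZ_diff(1)[OF uv(1,2)])
    have "YZ_norm z (\<lambda>n. u n - v n) \<le> 0"
      using graph_bounds(2)[OF d graph_diff[OF uv(1,2) A A]] uv by simp
    then have "YZ_norm z (\<lambda>n. u n - v n) = 0" by (simp add: YZ_norm_def)
    from YZ_norm_eq_0D[OF d this, of n] show "u n = v n" by simp
  qed
  have "A (\<lambda>n. u n + v n) = A u + A v" if "u \<in> YZ Y z" "v \<in> YZ Y z" for u v
    using YZ_add(1)[OF that] graph_unique A graph_add[OF that A[OF that(1)] A[OF that(2)]] by metis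
  moreover have "A (\<lambda>n. sY c (u n)) = sX c (A u)" if "u \<in> YZ Y z" for c u
    using YZ_scale(1)[OF that] graph_unique A graph_scale[OF that A[OF that]] by metis
  moreover have "YZ_norm z (inv_into (YZ Y z) A v) \<le> D * norm v" if "v \<in> A ` YZ Y z" for v
    using that graph_bounds(2) A inj by (auto simp: inv_into_f_f)
  ultimately show ?thesis
    unfolding YZ_embeds_def using inj graph_bounds(1) A by (intro exI[of _ A]) blast
qed

end


section \<open>From operators to vectors\<close>

lemma is_tree_vector_tree:
  fixes sX :: "'f::{real_normed_field,euclidean_space} \<Rightarrow> 'x::real_normed_vector \<Rightarrow> 'x"
    and sY :: "'f \<Rightarrow> 'y::real_normed_vector \<Rightarrow> 'y"
  assumes "normed_space_over sX" "normed_space_over sY"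
  shows "is_tree (vector_tree sY z sX D y)"
  unfolding is_tree_def
proof (intro ballI allI impI)
  interpret Xs: normed_space_over sX by fact
  interpret Ys: normed_space_over sY by fact
  fix s t assume s: "s \<in> vector_tree sY z sX D y" and "prefix t s"
  then obtain r where r: "s = t @ r" by (auto simp: prefix_def)
  show "t \<in> vector_tree sY z sX D y"
    unfolding vector_tree_def
  proof (intro CollectI allI)
    fix a :: "nat \<Rightarrow> 'f"
    define b where "b i = (if i < length t then a i else 0)" for i
    have "(\<Sum>i<length s. sX (b i) (s ! i)) = (\<Sum>i<length t. sX (a i) (t ! i))"
      by (rule sum.mono_neutral_cong_right) (auto simp: b_def r nth_append)
    moreover have "(\<Sum>i<length s. sY (b i) (y i n)) = (\<Sum>i<length t. sY (a i) (y i n))" for n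
      by (rule sum.mono_neutral_cong_right) (auto simp: b_def r)
    moreover have "norm (\<Sum>i<length s. sX (b i) (s ! i)) \<le> YZ_norm z (\<lambda>n. \<Sum>i<length s. sY (b i) (y i n))
      \<and> YZ_norm z (\<lambda>n. \<Sum>i<length s. sY (b i) (y i n)) \<le> D * norm (\<Sum>i<length s. sX (b i) (s ! i))"
      using s unfolding vector_tree_def by blast
    ultimately show "norm (\<Sum>i<length t. sX (a i) (t ! i)) \<le> YZ_norm z (\<lambda>n. \<Sum>i<length t. sY (a i) (y i n))
      \<and> YZ_norm z (\<lambda>n. \<Sum>i<length t. sY (a i) (y i n)) \<le> D * norm (\<Sum>i<length t. sX (a i) (t ! i))"
      by simp
  qed
qed

lemma vector_tree_closed:
  fixes sX :: "'f::{real_normed_field,euclidean_space} \<Rightarrow> 'x::real_normed_vector \<Rightarrow> 'x"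
    and sY :: "'f \<Rightarrow> 'y::real_normed_vector \<Rightarrow> 'y"
  assumes "normed_space_over sX"
    and s: "\<And>k. map (s k) [0..<n] \<in> vector_tree sY z sX D y"
    and l: "\<And>i. i < n \<Longrightarrow> (\<lambda>k. s k i) \<longlonglongrightarrow> l i"
  shows "map l [0..<n] \<in> vector_tree sY z sX D y"
proof -
  interpret Xs: normed_space_over sX by fact
  have "norm (\<Sum>i<n. sX (a i) (l i)) \<le> YZ_norm z (\<lambda>m. \<Sum>i<n. sY (a i) (y i m)) \<and>
      YZ_norm z (\<lambda>m. \<Sum>i<n. sY (a i) (y i m)) \<le> D * norm (\<Sum>i<n. sX (a i) (l i))" for a
  proof
    have lim: "(\<lambda>k. norm (\<Sum>i<n. sX (a i) (s k i))) \<longlonglongrightarrow> norm (\<Sum>i<n. sX (a i) (l i))"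
      by (intro tendsto_norm tendsto_sum Xs.tendsto_scale l) simp
    have b: "norm (\<Sum>i<n. sX (a i) (s k i)) \<le> YZ_norm z (\<lambda>m. \<Sum>i<n. sY (a i) (y i m))"
      "YZ_norm z (\<lambda>m. \<Sum>i<n. sY (a i) (y i m)) \<le> D * norm (\<Sum>i<n. sX (a i) (s k i))" for k
      using s[of k] unfolding vector_tree_def by simp_all
    show "norm (\<Sum>i<n. sX (a i) (l i)) \<le> YZ_norm z (\<lambda>m. \<Sum>i<n. sY (a i) (y i m))"
      using LIMSEQ_le_const2[OF lim] b(1) by blast
    show "YZ_norm z (\<lambda>m. \<Sum>i<n. sY (a i) (y i m)) \<le> D * norm (\<Sum>i<n. sX (a i) (l i))"
      using LIMSEQ_le_const[OF tendsto_mult[OF tendsto_const lim]] b(2) by blast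
  qed
  then show ?thesis by (simp add: vector_tree_def)
qed

text \<open>
  By linearity of the operators, \<open>\<Sum>k. a\<^sub>k A\<^bsub>m k\<^esub> v\<^sub>k = \<Sum>i. A\<^sub>i w\<^sub>i\<close>, where \<open>w\<close> is the combination
  with coefficients \<open>a\<^sub>k\<close> of the vectors \<open>v\<^sub>k\<close> as elements of the direct sum.  The condition \<open>m k \<le> k\<close> is what makes the
  \<open>k\<close>-th vector computable from an initial segment of length \<open>k + 1\<close>.
\<close>

lemma (in direct_sum_setting) operator_tree_to_vector_tree:
  fixes sX :: "'f \<Rightarrow> 'x::real_normed_vector \<Rightarrow> 'x"
  assumes "normed_space_over sX"
    and m: "\<And>k. m k \<le> k" and v: "\<And>k. v k \<in> Y (m k)"
    and As: "As \<in> operator_tree sY Y z sX C D"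
  shows "map (\<lambda>k. (As ! m k) (v k)) [0..<length As]
    \<in> vector_tree sY z sX D (\<lambda>k. coord_embed (m k) (v k))"
proof -
  interpret Xs: normed_space_over sX by fact
  let ?n = "length As"
  have op: "bounded_operator_on sY (Y i) sX (As ! i)" if "i < ?n" for i
    using As that unfolding operator_tree_def by blast
  have bnd: "norm (\<Sum>i<?n. (As ! i) (w i)) \<le> norm (\<Sum>i<?n. norm (w i) *\<^sub>R z i) \<and>
       norm (\<Sum>i<?n. norm (w i) *\<^sub>R z i) \<le> D * norm (\<Sum>i<?n. (As ! i) (w i))"
    if "\<And>i. i < ?n \<Longrightarrow> w i \<in> Y i" for w
    using As that unfolding operator_tree_def by blast
  have "norm (\<Sum>k<?n. sX (a k) ((As ! m k) (v k)))
        \<le> YZ_norm z (\<lambda>i. \<Sum>k<?n. sY (a k) (coord_embed (m k) (v k) i)) \<and>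
      YZ_norm z (\<lambda>i. \<Sum>k<?n. sY (a k) (coord_embed (m k) (v k) i))
        \<le> D * norm (\<Sum>k<?n. sX (a k) ((As ! m k) (v k)))" for a
  proof -
    define w where "w i = (\<Sum>k<?n. sY (a k) (coord_embed (m k) (v k) i))" for i
    have w_eq: "w = (\<lambda>i. \<Sum>k<?n. sY (a k) (coord_embed (m k) (v k) i))"
      by (simp add: w_def fun_eq_iff)
    have emb: "coord_embed (m k) (v k) i \<in> Y i" for k i
      using v Ys.subspace_0[OF subspace_Y] by (auto simp: coord_embed_def)
    have wY: "w i \<in> Y i" for i
      unfolding w_def by (intro Ys.subspace_sum[OF subspace_Y] Ys.subspace_scale[OF subspace_Y] emb)
    have w0: "w i = 0" if "i \<ge> ?n" for i
      unfolding w_def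
    proof (rule sum.neutral, rule ballI)
      fix k assume "k \<in> {..<?n}"
      then have "i \<noteq> m k" using that m[of k] by auto
      then show "sY (a k) (coord_embed (m k) (v k) i) = 0" by (simp add: coord_embed_def)
    qed
    have "(As ! i) (w i) = (\<Sum>k<?n. sX (a k) (if i = m k then (As ! m k) (v k) else 0))"
      if i: "i < ?n" for i
    proof -
      have add: "(As ! i) (p + q) = (As ! i) p + (As ! i) q" if "p \<in> Y i" "q \<in> Y i" for p q
        using op[OF i] that unfolding bounded_operator_on_def by blast
      have scale: "(As ! i) (sY c p) = sX c ((As ! i) p)" if "p \<in> Y i" for c p
        using op[OF i] that unfolding bounded_operator_on_def by blast
      have zero: "(As ! i) 0 = 0"
        using scale[of 0 0] Ys.subspace_0[OF subspace_Y] by simp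
      have "(As ! i) (\<Sum>k<N. sY (a k) (coord_embed (m k) (v k) i))
          = (\<Sum>k<N. sX (a k) ((As ! i) (coord_embed (m k) (v k) i)))" for N
      proof (induction N)
        case (Suc N)
        have "(\<Sum>k<N. sY (a k) (coord_embed (m k) (v k) i)) \<in> Y i"
          "sY (a N) (coord_embed (m N) (v N) i) \<in> Y i"
          by (intro Ys.subspace_sum[OF subspace_Y] Ys.subspace_scale[OF subspace_Y] emb)+
        then show ?case by (simp add: add scale[OF emb] Suc)
      qed (simp add: zero)
      then show ?thesis
        unfolding w_def by (auto simp: coord_embed_def zero intro!: sum.cong)
    qed
    then have "(\<Sum>i<?n. (As ! i) (w i))
        = (\<Sum>i<?n. \<Sum>k<?n. sX (a k) (if i = m k then (As ! m k) (v k) else 0))"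
      by simp
    also have "\<dots> = (\<Sum>k<?n. \<Sum>i<?n. sX (a k) (if i = m k then (As ! m k) (v k) else 0))"
      by (rule sum.swap)
    also have "\<dots> = (\<Sum>k<?n. sX (a k) ((As ! m k) (v k)))"
    proof (intro sum.cong refl)
      fix k assume "k \<in> {..<?n}"
      then have "m k < ?n" using m[of k] by simp
      then show "(\<Sum>i<?n. sX (a k) (if i = m k then (As ! m k) (v k) else 0))
          = sX (a k) ((As ! m k) (v k))"
        by (simp flip: Xs.scale_sum_right)
    qed
    finally show ?thesis
      using bnd[of w, OF wY] YZ_finite_support(2)[of w ?n, OF wY w0]
      unfolding w_eq[symmetric] by simp
  qed
  then show ?thesis by (simp add: vector_tree_def)
qed

theorem claim4p1:
  fixes sX :: "'f::{real_normed_field,euclidean_space} \<Rightarrow> 'x::banach \<Rightarrow> 'x"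
    and sZ :: "'f \<Rightarrow> 'z::banach \<Rightarrow> 'z"
    and sY :: "'f \<Rightarrow> 'y::real_normed_vector \<Rightarrow> 'y"
    and z :: "nat \<Rightarrow> 'z"
    and Y :: "nat \<Rightarrow> 'y set"
    and S :: "nat \<Rightarrow> nat \<Rightarrow> 'y"
    and y :: "nat \<Rightarrow> nat \<Rightarrow> 'y"
    and C D :: real
  assumes "normed_space_over sX"
    and "normed_space_over sZ"
    and "normed_space_over sY"
    and "one_unconditional_basis sZ z"
    and "\<And>n. module.subspace sY (Y n)"
    and "\<And>n. complete (Y n)"
    and "\<And>n. separable_space (top_of_set (Y n))"
    and "\<And>n. Y n \<noteq> {0}"
    and "\<And>n. range (S n) \<subseteq> Y n - {0}"
    and "\<And>n. Y n \<subseteq> closure (range (S n))"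
    and "range y = (\<Union>n. coord_embed n ` range (S n))"
    and "\<And>k. y ` {..<k} \<subseteq> (\<Union>i<k. coord_embed i ` Y i)"
    and "separable_space (euclidean :: 'x topology)"
    and "C \<ge> 1" and "D \<ge> 1"
    and "\<exists>T. T \<subseteq> operator_tree sY Y z sX C D \<and> is_tree T \<and> tree_order T = Omega1"
  shows "tree_order (vector_tree sY z sX D y) = Omega1 \<and> YZ_embeds sY Y z sX D"
proof -
  interpret direct_sum_setting sZ sY z Y
    using assms by (simp add: direct_sum_setting_def direct_sum_setting_axioms_def)
  interpret Xs: normed_space_over sX by fact
  let ?V = "vector_tree sY z sX D y"
  have "y k \<in> (\<Union>i<Suc k. coord_embed i ` Y i)" for k
    using subsetD[OF assms(12)[of "Suc k"], of "y k"] by simp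
  then have "\<exists>i w. i \<le> k \<and> w \<in> Y i \<and> y k = coord_embed i w" for k
    unfolding less_Suc_eq_le[symmetric] by blast
  then obtain m v where mv: "\<And>k. m k \<le> k" "\<And>k. v k \<in> Y (m k)" "\<And>k. y k = coord_embed (m k) (v k)"
    by metis
  obtain T where T: "T \<subseteq> operator_tree sY Y z sX C D" "is_tree T" "tree_order T = Omega1"
    using assms(16) by blast
  let ?f = "\<lambda>As. map (\<lambda>k. (As ! m k) (v k)) [0..<length As]"
  have y: "y = (\<lambda>k. coord_embed (m k) (v k))" using mv(3) by blast
  have fV: "?f As \<in> ?V" if "As \<in> T" for As
    unfolding y by (rule operator_tree_to_vector_tree[OF assms(1) mv(1,2)]) (use that T(1) in blast)
  have mono: "strict_prefix (?f s) (?f t)" if st: "strict_prefix s t" for s t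
  proof -
    obtain r where r: "t = s @ r" "r \<noteq> []" using st by (auto simp: strict_prefix_def prefix_def)
    have nth: "(s @ r) ! m k = s ! m k" if "k < length s" for k
      using mv(1)[of k] that by (simp add: nth_append)
    have "[0..<length t] = [0..<length s] @ [length s..<length t]"
      by (metis append_Nil2 le_add1 length_append r(1) upt_add_eq_append zero_le le_add_diff_inverse)
    then have "?f t = ?f s @ map (\<lambda>k. (t ! m k) (v k)) [length s..<length t]"
      using nth by (simp add: r(1))
    then show ?thesis using r by (simp add: strict_prefix_def)
  qed
  have "tree_deriv ?V \<xi> \<noteq> {}" for \<xi>
    using tree_deriv_image[of T ?f ?V, OF fV mono] T(3) unfolding tree_order_Omega1_iff by blast
  then have ord: "tree_order ?V = Omega1" by (simp add: tree_order_Omega1_iff)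
  obtain x where x: "\<And>n. map x [0..<n] \<in> ?V"
    by (rule closed_tree_infinite_branch[OF assms(13) is_tree_vector_tree[OF assms(1,3)] ord])
      (erule vector_tree_closed[OF assms(1)], assumption, blast)
  interpret equivalent_sequences sZ sY z Y sX x y D
  proof
    show "map x [0..<n] \<in> ?V" for n by (rule x)
    show "y k \<in> (\<Union>i. coord_embed i ` Y i)" for k using mv by auto
    fix i u and e :: real assume "u \<in> Y i" "e > 0"
    then obtain w where w: "w \<in> range (S i)" "dist w u < e"
      using assms(10)[of i] closure_approachable by blast
    have "coord_embed i w \<in> range y"
      unfolding assms(11) by (intro UN_I[of i] UNIV_I imageI w(1))
    then obtain k where "coord_embed i w = y k" by (rule rangeE)
    then have "y k = coord_embed i w" by (rule sym)
    then show "\<exists>k w. w \<in> Y i \<and> y k = coord_embed i w \<and> norm (u - w) < e"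
      using w assms(9)[of i]
      by (intro exI[of _ k] exI[of _ w]) (auto simp: dist_norm norm_minus_commute)
  qed
  show ?thesis using ord YZ_embeds_of_branch by blast
qed

end
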